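(* Let $X$ be a Tychonoff space, and let $\delta: X\to C_s\big(C_k(X)\big)$ be the canonical map, $\delta(x)(f):=f(x)$. Then the following assertions are equivalent: (i) $X$ is a sequentially $\mathbb{R}$-Ascoli space, i.e. every convergent sequence in $C_k(X)$ is evenly continuous; (ii) $\delta$ is continuous; (iii) $\delta$ is an embedding (a homeomorphism onto its image); (iv) each point $x\in X$ is contained in a dense sequentially Ascoli subspace of $X$; (v) every convergent sequence in $C_k(X)$ is equicontinuous, i.e. $X$ is sequentially Ascoli; (vi) every strongly functionally compact-finite sequence of functionally closed subsets of $X$ is locally finite.
   Context: $C_k(X)$ is the space $C(X)$ of all continuous real-valued functions on $X$ with the compact-open topology. A convergent sequence is regarded as a set that includes its limit. For a topological space $T$, $C_s(T)$ is the set $C(T)$ of continuous real-valued functions on $T$ with the topology having as subbase the sets $\{F\in C(T): F(S)\subseteq U\}$, where $U\subseteq\mathbb{R}$ is open and $S\subseteq T$ is a finite union of convergent sequences (with their limits). A set $A\subseteq C_k(X)$ is evenly continuous if the evaluation map $A\times X\to\mathbb{R}$, $(f,x)\mapsto f(x)$, is continuous. A set $A\subseteq C(X)$ is equicontinuous if for every $x\in X$ and $\varepsilon>0$ there is a neighborhood $O_x$ of $x$ with $|f(t)-f(x)|<\varepsilon$ for all $t\in O_x$ and $f\in A$. A Tychonoff space is sequentially Ascoli if every convergent sequence in its $C_k$-space is equicontinuous. A subset of $X$ is functionally closed if it is the zero set of a continuous real-valued function, and functionally open if its complement is functionally closed. A family $\{A_i\}_{i\in I}$ of subsets of $X$ is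 compact-finite if for every compact $K\subseteq X$ the set $\{i\in I: K\cap A_i\neq\emptyset\}$ is finite; it is locally finite if every point of $X$ has a neighborhood $U$ such that $\{i\in I: U\cap A_i\ne\emptyset\}$ is finite; it is strongly functionally compact-finite if for every $i\in I$ there is a functionally open set $U_i\supseteq A_i$ such that the family $\{U_i\}_{i\in I}$ is compact-finite. *)

theory Defs
  imports "HOL-Analysis.Analysis"
begin

definition tychonoff_space :: "'a topology \<Rightarrow> bool" where
  "tychonoff_space X \<longleftrightarrow> completely_regular_space X \<and> Hausdorff_space X"

text \<open>Elements of \<open>C(X)\<close> are functions on the carrier only; they are represented by
  HOL functions that take the value \<^const>\<open>undefined\<close> off \<open>topspace X\<close>, so that equality in
  \<open>C(X)\<close> is equality on \<open>topspace X\<close>.\<close>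

definition real_cfuns :: "'a topology \<Rightarrow> ('a \<Rightarrow> real) set" where
  "real_cfuns X = {f \<in> extensional (topspace X). continuous_map X euclideanreal f}"

definition set_open_topology :: "'a topology \<Rightarrow> 'a set set \<Rightarrow> ('a \<Rightarrow> real) topology" where
  "set_open_topology X \<S> =
     topology_generated_by {{f \<in> real_cfuns X. f ` S \<subseteq> U} | S U. S \<in> \<S> \<and> open U}"

definition Ck :: "'a topology \<Rightarrow> ('a \<Rightarrow> real) topology" where
  "Ck X = set_open_topology X {K. compactin X K}"

text \<open>A convergent sequence is treated as the set of its terms together with a limit;
  \<^const>\<open>limitin\<close> alone puts only eventually all terms in the space.\<close>

definition convergent_seq_set :: "'a topology \<Rightarrow> 'a set \<Rightarrow> bool" where
  "convergent_seq_set X S \<longleftrightarrow>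
     (\<exists>s l. range s \<subseteq> topspace X \<and> limitin X s l sequentially \<and> S = insert l (range s))"

definition Cs :: "'a topology \<Rightarrow> ('a \<Rightarrow> real) topology" where
  "Cs X = set_open_topology X {\<Union>\<F> | \<F>. finite \<F> \<and> (\<forall>S\<in>\<F>. convergent_seq_set X S)}"

definition delta :: "'a topology \<Rightarrow> 'a \<Rightarrow> ('a \<Rightarrow> real) \<Rightarrow> real" where
  "delta X x = restrict (\<lambda>f. f x) (topspace (Ck X))"

definition evenly_continuous :: "'a topology \<Rightarrow> ('a \<Rightarrow> real) set \<Rightarrow> bool" where
  "evenly_continuous X A \<longleftrightarrow>
     continuous_map (prod_topology (subtopology (Ck X) A) X) euclideanreal (\<lambda>(f, x). f x)"

definition equicontinuous :: "'a topology \<Rightarrow> ('a \<Rightarrow> real) set \<Rightarrow> bool" where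
  "equicontinuous X A \<longleftrightarrow>
     (\<forall>x \<in> topspace X. \<forall>\<epsilon>>0. \<exists>U. openin X U \<and> x \<in> U \<and> (\<forall>t\<in>U. \<forall>f\<in>A. \<bar>f t - f x\<bar> < \<epsilon>))"

definition sequentially_R_Ascoli :: "'a topology \<Rightarrow> bool" where
  "sequentially_R_Ascoli X \<longleftrightarrow>
     tychonoff_space X \<and> (\<forall>S. convergent_seq_set (Ck X) S \<longrightarrow> evenly_continuous X S)"

definition sequentially_Ascoli :: "'a topology \<Rightarrow> bool" where
  "sequentially_Ascoli X \<longleftrightarrow>
     tychonoff_space X \<and> (\<forall>S. convergent_seq_set (Ck X) S \<longrightarrow> equicontinuous X S)"

definition functionally_closed :: "'a topology \<Rightarrow> 'a set \<Rightarrow> bool" where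
  "functionally_closed X A \<longleftrightarrow>
     (\<exists>f. continuous_map X euclideanreal f \<and> A = {x \<in> topspace X. f x = 0})"

definition functionally_open :: "'a topology \<Rightarrow> 'a set \<Rightarrow> bool" where
  "functionally_open X U \<longleftrightarrow> U \<subseteq> topspace X \<and> functionally_closed X (topspace X - U)"

text \<open>Finiteness conditions on indexed families: indices, not distinct members, are counted.\<close>

definition compact_finite :: "'a topology \<Rightarrow> 'i set \<Rightarrow> ('i \<Rightarrow> 'a set) \<Rightarrow> bool" where
  "compact_finite X I A \<longleftrightarrow> (\<forall>K. compactin X K \<longrightarrow> finite {i \<in> I. K \<inter> A i \<noteq> {}})"

definition locally_finite_family :: "'a topology \<Rightarrow> 'i set \<Rightarrow> ('i \<Rightarrow> 'a set) \<Rightarrow> bool" where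
  "locally_finite_family X I A \<longleftrightarrow>
     (\<forall>x \<in> topspace X. \<exists>U. openin X U \<and> x \<in> U \<and> finite {i \<in> I. U \<inter> A i \<noteq> {}})"

definition strongly_functionally_compact_finite ::
    "'a topology \<Rightarrow> 'i set \<Rightarrow> ('i \<Rightarrow> 'a set) \<Rightarrow> bool" where
  "strongly_functionally_compact_finite X I A \<longleftrightarrow>
     (\<exists>U. (\<forall>i\<in>I. functionally_open X (U i) \<and> A i \<subseteq> U i) \<and> compact_finite X I U)"

lemma topspace_set_open_topology:
  assumes "{} \<in> \<S>"
  shows "topspace (set_open_topology X \<S>) = real_cfuns X"
proof -
  have "real_cfuns X \<in> {{f \<in> real_cfuns X. f ` S \<subseteq> U} | S U. S \<in> \<S> \<and> open U}"
    using assms by (auto intro!: exI[of _ "{}"])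
  then show ?thesis
    unfolding set_open_topology_def topology_generated_by_topspace by auto
qed

lemma topspace_Ck [simp]: "topspace (Ck X) = real_cfuns X"
  by (simp add: Ck_def topspace_set_open_topology)

lemma topspace_Cs [simp]: "topspace (Cs X) = real_cfuns X"
  unfolding Cs_def by (rule topspace_set_open_topology) (auto intro!: exI[of _ "{}"])

end

theory Submission
  imports Defs
begin

text \<open>Everything is compared with equicontinuity of the convergent sequences \<open>s n \<longlonglongrightarrow> l\<close> of \<open>C\<^sub>k(X)\<close>.
  Even continuity is the same because \<open>{s n} \<union> {l}\<close> is compact; openness of \<open>\<delta>\<close> onto its image
  needs only the constant sequences and complete regularity; and an equicontinuity estimate
  on a dense subspace extends to its closure. For (vi), a compact-finite family gives Urysohn functions
  \<open>s n \<longlonglongrightarrow> 0\<close>, and conversely \<open>s n \<longlonglongrightarrow> l\<close> gives the family \<open>{\<bar>s n - l\<bar> \<ge> \<epsilon>/3} \<subseteq> {\<bar>s n - l\<bar> > \<epsilon>/4}\<close>.\<close>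

section \<open>Members of \<open>real_cfuns\<close> and subbasic neighbourhoods\<close>

lemma real_cfunsD: "f \<in> real_cfuns X \<Longrightarrow> continuous_map X euclideanreal f"
  by (simp add: real_cfuns_def)

lemma restrict_in_real_cfuns:
  assumes "continuous_map X euclideanreal f"
  shows "restrict f (topspace X) \<in> real_cfuns X"
  unfolding real_cfuns_def using assms
  by (auto intro: continuous_map_eq)

lemma openin_set_open_topology:
  assumes "S \<in> \<S>" "open U"
  shows "openin (set_open_topology X \<S>) {f \<in> real_cfuns X. f ` S \<subseteq> U}"
  unfolding set_open_topology_def
  by (rule topology_generated_by_Basis) (use assms in blast)

text \<open>Convergence to \<open>l\<close> may be tested on subbasic sets: induct on the generation
  of \<open>W\<close> from the subbase. The assumption \<open>l \<in> W\<close> travels through the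
  induction, so for a union it suffices to treat one member that contains \<open>l\<close>.\<close>

lemma eventually_set_open_topology:
  assumes "openin (set_open_topology X \<S>) W" "l \<in> W"
    and sub: "\<And>S U. \<lbrakk>S \<in> \<S>; open U; l \<in> real_cfuns X; l ` S \<subseteq> U\<rbrakk> \<Longrightarrow>
      \<forall>\<^sub>F n in F. s n \<in> real_cfuns X \<and> s n ` S \<subseteq> U"
  shows "\<forall>\<^sub>F n in F. s n \<in> W"
proof -
  have "generate_topology_on {{f \<in> real_cfuns X. f ` S \<subseteq> U} | S U. S \<in> \<S> \<and> open U} W"
    using assms(1) unfolding set_open_topology_def openin_topology_generated_by_iff .
  then show ?thesis using \<open>l \<in> W\<close>
  proof (induction rule: generate_topology_on.induct)
    case (Int a b)
    then show ?case by (auto simp: eventually_conj_iff)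
  next
    case (UN K)
    then obtain k where k: "k \<in> K" "l \<in> k" by blast
    from UN(2)[OF this] show ?case
      by (rule eventually_mono) (use k in blast)
  next
    case (Basis b)
    then show ?case using sub by auto
  qed simp
qed

text \<open>\<open>C\<close> is compact and disjoint from the closed set \<open>-U\<close>, hence at
  positive distance from it.\<close>

lemma compact_subset_open_margin:
  fixes C :: "real set"
  assumes "compact C" "open U" "C \<subseteq> U"
  obtains e where "e > 0" "\<And>x y. \<lbrakk>x \<in> C; \<bar>y - x\<bar> < e\<rbrakk> \<Longrightarrow> y \<in> U"
proof -
  obtain d where "d > 0" and d: "\<forall>x\<in>C. \<forall>y\<in>-U. d \<le> dist x y"
    using separate_compact_closed[of C "-U"] assms by auto
  show thesis
  proof
    fix x y assume "x \<in> C" "\<bar>y - x\<bar> < d"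
    then show "y \<in> U" using d by (force simp: dist_real_def)
  qed fact
qed

section \<open>Convergence in the compact-open topology\<close>

text \<open>The compact-open topology is that of uniform convergence on compact sets. Membership of
  \<open>s n\<close> stays under the eventuality because \<open>limitin\<close> says nothing about
  early terms.\<close>

lemma limitin_Ck_iff:
  "limitin (Ck X) s l F \<longleftrightarrow> l \<in> real_cfuns X \<and>
     (\<forall>K \<epsilon>. compactin X K \<and> \<epsilon> > 0 \<longrightarrow>
        (\<forall>\<^sub>F n in F. s n \<in> real_cfuns X \<and> (\<forall>x\<in>K. \<bar>s n x - l x\<bar> < \<epsilon>)))"
    (is "?L \<longleftrightarrow> ?R")
proof
  assume L: ?L
  then have l: "l \<in> real_cfuns X" by (auto dest: limitin_topspace)
  have "\<forall>\<^sub>F n in F. s n \<in> real_cfuns X \<and> (\<forall>x\<in>K. \<bar>s n x - l x\<bar> < \<epsilon>)"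
    if K: "compactin X K" and e: "\<epsilon> > 0" for K and \<epsilon> :: real
  proof -
    have "compact (l ` K)"
      using image_compactin[OF K real_cfunsD[OF l]] by simp
    then obtain C where C: "finite C" "l ` K \<subseteq> (\<Union>c\<in>C. ball c (\<epsilon>/3))"
      using e unfolding compact_eq_totally_bounded by (meson divide_pos_pos zero_less_numeral)
    \<comment> \<open>Closed balls make \<open>P c\<close> closed in \<open>K\<close>, hence
      compact. Their radius \<epsilon>/3 leaves room inside the open ball of radius \<epsilon>/2, so
      \<open>l\<close> lies in the subbasic set given by \<open>P c\<close>, and \<epsilon>/3 +
      \<epsilon>/2 < \<epsilon> gives the final bound.\<close>
    define P where "P c = K \<inter> {y \<in> topspace X. l y \<in> cball c (\<epsilon>/3)}" for c
    have P: "compactin X (P c)" for c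
      unfolding P_def Int_commute[of K]
      by (rule closed_Int_compactin[OF _ K])
         (rule closedin_continuous_map_preimage[OF real_cfunsD[OF l]], simp)
    have "\<forall>\<^sub>F n in F. s n \<in> {f \<in> real_cfuns X. f ` P c \<subseteq> ball c (\<epsilon>/2)}" for c
    proof (rule limitinD[OF L])
      show "openin (Ck X) {f \<in> real_cfuns X. f ` P c \<subseteq> ball c (\<epsilon>/2)}"
        unfolding Ck_def by (rule openin_set_open_topology) (use P in auto)
      show "l \<in> {f \<in> real_cfuns X. f ` P c \<subseteq> ball c (\<epsilon>/2)}"
        using l e by (auto simp: P_def)
    qed
    then have "\<forall>\<^sub>F n in F. \<forall>c\<in>C. s n ` P c \<subseteq> ball c (\<epsilon>/2)"
      using C(1) by (simp add: eventually_ball_finite_distrib eventually_conj_iff)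
    \<comment> \<open>Membership is obtained separately, since \<open>C\<close> may be empty when
      \<open>K\<close> is.\<close>
    moreover have "\<forall>\<^sub>F n in F. s n \<in> real_cfuns X"
      using limitinD[OF L openin_topspace] l by simp
    ultimately show ?thesis
    proof eventually_elim
      case (elim n)
      have "\<bar>s n x - l x\<bar> < \<epsilon>" if x: "x \<in> K" for x
      proof -
        obtain c where c: "c \<in> C" "\<bar>c - l x\<bar> < \<epsilon>/3"
          using C(2) x by (auto simp: dist_real_def)
        then have "x \<in> P c"
          using x compactin_subset_topspace[OF K] by (auto simp: P_def dist_real_def)
        then have "\<bar>c - s n x\<bar> < \<epsilon>/2"
          using elim(1) c(1) by (force simp: dist_real_def)
        with c(2) show ?thesis using e by linarith
      qed
      with elim show ?case by blast
    qed
  qed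
  with l show ?R by blast
next
  assume R: ?R
  show ?L
    unfolding limitin_def
  proof (intro conjI allI impI)
    show "l \<in> topspace (Ck X)" using R by simp
    fix W assume "openin (Ck X) W \<and> l \<in> W"
    then have W: "openin (set_open_topology X {K. compactin X K}) W" "l \<in> W"
      by (auto simp: Ck_def)
    show "\<forall>\<^sub>F n in F. s n \<in> W"
    proof (rule eventually_set_open_topology[OF W])
      fix K and U :: "real set"
      assume "K \<in> {K. compactin X K}" and "open U" and l: "l \<in> real_cfuns X" and "l ` K \<subseteq> U"
      then have K: "compactin X K" by simp
      have "compact (l ` K)"
        using image_compactin[OF K real_cfunsD[OF l]] by simp
      then obtain e where e: "e > 0" "\<And>x y. \<lbrakk>x \<in> l ` K; \<bar>y - x\<bar> < e\<rbrakk> \<Longrightarrow> y \<in> U"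
        using compact_subset_open_margin \<open>open U\<close> \<open>l ` K \<subseteq> U\<close> by metis
      have "\<forall>\<^sub>F n in F. s n \<in> real_cfuns X \<and> (\<forall>x\<in>K. \<bar>s n x - l x\<bar> < e)"
        using R K e(1) by blast
      then show "\<forall>\<^sub>F n in F. s n \<in> real_cfuns X \<and> s n ` K \<subseteq> U"
        by (rule eventually_mono) (use e(2) in blast)
    qed
  qed
qed

section \<open>Convergent sequences as sets, and evaluation at a point\<close>

lemma convergent_seq_set_compactin:
  assumes "convergent_seq_set X S"
  shows "compactin X S"
  using assms compactin_sequence_with_limit[OF _ order_refl]
  unfolding convergent_seq_set_def by auto

lemma convergent_seq_set_subset:
  "convergent_seq_set X S \<Longrightarrow> S \<subseteq> topspace X"
  by (simp add: compactin_subset_topspace convergent_seq_set_compactin)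

lemma convergent_seq_set_singleton:
  "x \<in> topspace X \<Longrightarrow> convergent_seq_set X {x}"
  unfolding convergent_seq_set_def by (intro exI[of _ "\<lambda>_. x"] exI[of _ x]) auto

text \<open>The singleton of \<open>x\<close> is compact, so preimages of open sets are themselves
  subbasic.\<close>

lemma continuous_map_eval:
  assumes "x \<in> topspace X"
  shows "continuous_map (Ck X) euclideanreal (\<lambda>f. f x)"
  unfolding continuous_map_def
proof (intro conjI allI impI)
  fix U :: "real set" assume "openin euclideanreal U"
  then show "openin (Ck X) {f \<in> topspace (Ck X). f x \<in> U}"
    using openin_set_open_topology[of "{x}" "{K. compactin X K}" U X] assms
    by (simp add: Ck_def[symmetric])
qed simp

lemma delta_in_real_cfuns:
  "x \<in> topspace X \<Longrightarrow> delta X x \<in> real_cfuns (Ck X)"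
  unfolding delta_def by (rule restrict_in_real_cfuns) (rule continuous_map_eval)

lemma continuous_map_real_iff:
  "continuous_map X euclideanreal f \<longleftrightarrow>
     (\<forall>x\<in>topspace X. \<forall>\<epsilon>>0. \<exists>U. openin X U \<and> x \<in> U \<and> (\<forall>y\<in>U. \<bar>f y - f x\<bar> < \<epsilon>))"
  using Met_TC.continuous_map_to_metric[of X f]
  by (simp add: mtopology_is_euclidean dist_real_def abs_minus_commute)

lemma delta_apply: "f \<in> real_cfuns X \<Longrightarrow> delta X x f = f x"
  by (simp add: delta_def)

section \<open>Even continuity and equicontinuity\<close>

text \<open>Forwards, a tube argument: joint continuity at each \<open>(g, x)\<close> gives a box,
  finitely many boxes cover the compact \<open>S\<close>, and their \<open>X\<close>-sides are
  intersected. Backwards, \<open>f t\<close> is compared with \<open>g x\<close> through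
  \<open>f x\<close>: equicontinuity bounds the first difference and continuity of evaluation the
  second.\<close>

lemma evenly_continuous_iff_equicontinuous:
  assumes S: "compactin (Ck X) S"
  shows "evenly_continuous X S \<longleftrightarrow> equicontinuous X S"
proof -
  have sub: "S \<subseteq> real_cfuns X"
    using compactin_subset_topspace[OF S] by simp
  then have top: "topspace (prod_topology (subtopology (Ck X) S) X) = S \<times> topspace X"
    by auto
  show ?thesis
  proof
    assume ec: "evenly_continuous X S"
    show "equicontinuous X S"
      unfolding equicontinuous_def
    proof (intro ballI allI impI)
      fix x and \<epsilon> :: real assume x: "x \<in> topspace X" and e: "\<epsilon> > 0"
      \<comment> \<open>Half of \<epsilon>, because \<open>f t\<close> and \<open>f x\<close> will
        both be compared with \<open>g x\<close>.\<close>
      have "\<exists>W U. openin (Ck X) W \<and> g \<in> W \<and> openin X U \<and> x \<in> U \<and>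
              (\<forall>h\<in>W \<inter> S. \<forall>y\<in>U. \<bar>h y - g x\<bar> < \<epsilon>/2)" if g: "g \<in> S" for g
      proof -
        let ?P = "{p \<in> topspace (prod_topology (subtopology (Ck X) S) X).
          (case p of (f, y) \<Rightarrow> f y) \<in> ball (g x) (\<epsilon>/2)}"
        have "openin (prod_topology (subtopology (Ck X) S) X) ?P"
          using ec unfolding evenly_continuous_def
          by (rule openin_continuous_map_preimage) simp
        moreover have "(g, x) \<in> ?P"
          unfolding top using g x e by simp
        ultimately obtain V U where V: "openin (subtopology (Ck X) S) V" "openin X U"
            "g \<in> V" "x \<in> U" "V \<times> U \<subseteq> ?P"
          unfolding openin_prod_topology_alt by (elim allE[of _ g] allE[of _ x] impE) blast+
        then obtain W where W: "openin (Ck X) W" "V = W \<inter> S"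
          by (auto simp: openin_subtopology)
        have "\<bar>h y - g x\<bar> < \<epsilon>/2" if "h \<in> W \<inter> S" "y \<in> U" for h y
        proof -
          have "(h, y) \<in> ?P" using V(5) W(2) that by blast
          then show ?thesis by (simp add: dist_real_def abs_minus_commute)
        qed
        with V W show ?thesis by blast
      qed
      then obtain W U where WU: "\<And>g. g \<in> S \<Longrightarrow> openin (Ck X) (W g) \<and> g \<in> W g \<and>
          openin X (U g) \<and> x \<in> U g \<and> (\<forall>h\<in>W g \<inter> S. \<forall>y\<in>U g. \<bar>h y - g x\<bar> < \<epsilon>/2)"
        by metis
      then have "S \<subseteq> \<Union>(W ` S)" "\<And>B. B \<in> W ` S \<Longrightarrow> openin (Ck X) B" by auto
      then obtain \<F> where "finite \<F>" "\<F> \<subseteq> W ` S" "S \<subseteq> \<Union>\<F>"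
        using S unfolding compactin_def by metis
      then obtain T where T: "finite T" "T \<subseteq> S" "S \<subseteq> \<Union>(W ` T)"
        by (metis finite_subset_image)
      \<comment> \<open>For empty \<open>T\<close> the intersection is \<open>UNIV\<close>; the
        factor \<open>topspace X\<close> keeps the set open in that case.\<close>
      let ?V = "topspace X \<inter> \<Inter>(U ` T)"
      have "openin X ?V"
      proof (cases "T = {}")
        case False
        then have "openin X (\<Inter>(U ` T))" using T WU by (intro openin_Inter) auto
        then show ?thesis by blast
      qed simp
      moreover have "x \<in> ?V" using x T WU by auto
      moreover have "\<bar>f t - f x\<bar> < \<epsilon>" if t: "t \<in> ?V" and f: "f \<in> S" for t f
      proof -
        obtain g where g: "g \<in> T" "f \<in> W g" using T f by auto
        then have "\<bar>f t - g x\<bar> < \<epsilon>/2" "\<bar>f x - g x\<bar> < \<epsilon>/2"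
          using WU[of g] T t f x by auto
        then show ?thesis by linarith
      qed
      ultimately show "\<exists>U. openin X U \<and> x \<in> U \<and> (\<forall>t\<in>U. \<forall>f\<in>S. \<bar>f t - f x\<bar> < \<epsilon>)"
        by (intro exI[of _ ?V]) auto
    qed
  next
    assume eq: "equicontinuous X S"
    show "evenly_continuous X S"
      unfolding evenly_continuous_def continuous_map_real_iff[of "prod_topology _ _"] top
    proof (intro ballI allI impI)
      fix p and \<epsilon> :: real assume "p \<in> S \<times> topspace X" and e: "\<epsilon> > 0"
      then obtain g x where p: "p = (g, x)" "g \<in> S" "x \<in> topspace X" by blast
      obtain U where U: "openin X U" "x \<in> U" "\<And>t f. t \<in> U \<Longrightarrow> f \<in> S \<Longrightarrow> \<bar>f t - f x\<bar> < \<epsilon>/2"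
        using eq p e unfolding equicontinuous_def by (meson half_gt_zero)
      obtain W where W: "openin (Ck X) W" "g \<in> W" "\<And>f. f \<in> W \<Longrightarrow> \<bar>f x - g x\<bar> < \<epsilon>/2"
        using continuous_map_eval[OF p(3)] sub p e unfolding continuous_map_real_iff[of "Ck X"]
        by (metis half_gt_zero subsetD topspace_Ck)
      let ?N = "(W \<inter> S) \<times> U"
      have "openin (prod_topology (subtopology (Ck X) S) X) ?N"
        using U W by (auto simp: openin_prod_Times_iff openin_subtopology)
      moreover have "p \<in> ?N" using p U W by simp
      moreover have "\<bar>f t - g x\<bar> < \<epsilon>" if "(f, t) \<in> ?N" for f t
        proof -
        have "\<bar>f t - f x\<bar> < \<epsilon>/2" "\<bar>f x - g x\<bar> < \<epsilon>/2"
          using U(3)[of t f] W(3)[of f] that by blast+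
        then show ?thesis by linarith
      qed
      ultimately show "\<exists>N. openin (prod_topology (subtopology (Ck X) S) X) N \<and> p \<in> N \<and>
          (\<forall>q\<in>N. \<bar>(case q of (f, x) \<Rightarrow> f x) - (case p of (f, x) \<Rightarrow> f x)\<bar> < \<epsilon>)"
        unfolding p(1) by (intro exI[of _ ?N]) auto
    qed
  qed
qed

lemma sequentially_R_Ascoli_iff: "sequentially_R_Ascoli X \<longleftrightarrow> sequentially_Ascoli X"
  unfolding sequentially_R_Ascoli_def sequentially_Ascoli_def
  using evenly_continuous_iff_equicontinuous convergent_seq_set_compactin by blast

section \<open>Continuity of the canonical map\<close>

text \<open>The set on the right is the preimage under \<open>delta X\<close> of the subbasic set
  given by \<open>S\<close> and \<open>U\<close>. A finite union of convergent sequences only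
  intersects finitely many such preimages, so single sequences suffice.\<close>

lemma continuous_map_delta_iff:
  "continuous_map X (Cs (Ck X)) (delta X) \<longleftrightarrow>
     (\<forall>S U. convergent_seq_set (Ck X) S \<and> open U \<longrightarrow> openin X {x \<in> topspace X. \<forall>f\<in>S. f x \<in> U})"
proof (intro iffI allI impI)
  fix S and U :: "real set"
  assume cont: "continuous_map X (Cs (Ck X)) (delta X)"
    and SU: "convergent_seq_set (Ck X) S \<and> open U"
  have S: "S \<subseteq> real_cfuns X"
    using SU convergent_seq_set_subset by fastforce
  have "openin (Cs (Ck X)) {F \<in> real_cfuns (Ck X). F ` S \<subseteq> U}"
    unfolding Cs_def by (rule openin_set_open_topology) (use SU in \<open>auto intro!: exI[of _ "{S}"]\<close>)
  from openin_continuous_map_preimage[OF cont this]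
  show "openin X {x \<in> topspace X. \<forall>f\<in>S. f x \<in> U}"
    by (rule back_subst[of "openin X"])
       (use S in \<open>auto simp: delta_in_real_cfuns delta_apply subset_iff\<close>)
next
  assume *: "\<forall>S U. convergent_seq_set (Ck X) S \<and> open U \<longrightarrow> openin X {x \<in> topspace X. \<forall>f\<in>S. f x \<in> U}"
  show "continuous_map X (Cs (Ck X)) (delta X)"
    unfolding Cs_def set_open_topology_def
  proof (rule continuous_on_generated_topo)
    have eq: "\<Union>{{f \<in> real_cfuns (Ck X). f ` S \<subseteq> U} |S U.
        S \<in> {\<Union>\<F> |\<F>. finite \<F> \<and> (\<forall>S\<in>\<F>. convergent_seq_set (Ck X) S)} \<and> open U} = real_cfuns (Ck X)"
      (is "\<Union>?G = _")
      using topspace_Cs[of "Ck X"]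
      unfolding Cs_def set_open_topology_def topology_generated_by_topspace .
    show "delta X ` topspace X \<subseteq> \<Union>?G"
      unfolding eq by (auto intro: delta_in_real_cfuns)
  next
    fix B
    assume "B \<in> {{f \<in> real_cfuns (Ck X). f ` S \<subseteq> U} |S U.
        S \<in> {\<Union>\<F> |\<F>. finite \<F> \<and> (\<forall>S\<in>\<F>. convergent_seq_set (Ck X) S)} \<and> open U}"
    then obtain \<F> U where B: "B = {f \<in> real_cfuns (Ck X). f ` \<Union>\<F> \<subseteq> U}" "open U" "finite \<F>"
        and \<F>: "\<And>S. S \<in> \<F> \<Longrightarrow> convergent_seq_set (Ck X) S"
      by blast
    have sub: "f \<in> real_cfuns X" if "S \<in> \<F>" "f \<in> S" for S f
      using convergent_seq_set_subset[OF \<F>] that by auto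
    have "openin X (topspace X \<inter> \<Inter>((\<lambda>S. {x \<in> topspace X. \<forall>f\<in>S. f x \<in> U}) ` \<F>))"
      using \<F> * B by (intro openin_Int_Inter) auto
    then show "openin X (delta X -` B \<inter> topspace X)"
      by (rule back_subst[of "openin X"])
         (use sub in \<open>auto simp: B delta_in_real_cfuns delta_apply[OF sub] image_subset_iff\<close>)
  qed
qed

text \<open>The values of \<open>S\<close> at \<open>x\<close> form a compact subset of
  \<open>U\<close>, which leaves a margin \<open>e\<close>; equicontinuity at \<open>x\<close> with
  this \<open>e\<close> keeps all \<open>f t\<close> in \<open>U\<close>.\<close>

lemma equicontinuous_imp_continuous_map_delta:
  assumes "\<And>S. convergent_seq_set (Ck X) S \<Longrightarrow> equicontinuous X S"
  shows "continuous_map X (Cs (Ck X)) (delta X)"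
  unfolding continuous_map_delta_iff
proof (intro allI impI)
  fix S and U :: "real set" assume SU: "convergent_seq_set (Ck X) S \<and> open U"
  let ?V = "{x \<in> topspace X. \<forall>f\<in>S. f x \<in> U}"
  show "openin X ?V"
  proof (subst openin_subopen, intro ballI)
    fix x assume x: "x \<in> ?V"
    have "compact ((\<lambda>f. f x) ` S)"
      using image_compactin[OF _ continuous_map_eval] convergent_seq_set_compactin SU x by force
    moreover have "(\<lambda>f. f x) ` S \<subseteq> U" using x by auto
    ultimately obtain e where e: "e > 0" "\<And>a y. \<lbrakk>a \<in> (\<lambda>f. f x) ` S; \<bar>y - a\<bar> < e\<rbrakk> \<Longrightarrow> y \<in> U"
      using compact_subset_open_margin SU by metis
    obtain W where W: "openin X W" "x \<in> W" "\<forall>t\<in>W. \<forall>f\<in>S. \<bar>f t - f x\<bar> < e"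
      using assms[of S, unfolded equicontinuous_def, rule_format, of x e] SU x e(1) by auto
    have "W \<subseteq> ?V"
    proof
      fix t assume t: "t \<in> W"
      then have "f t \<in> U" if "f \<in> S" for f
        using e(2)[of "f x" "f t"] W(3) that by blast
      then show "t \<in> ?V" using t openin_subset[OF W(1)] by blast
    qed
    with W show "\<exists>T. openin X T \<and> x \<in> T \<and> T \<subseteq> ?V" by blast
  qed
qed

text \<open>Equicontinuity of \<open>s n \<longlonglongrightarrow> l\<close> at \<open>x\<close> is continuity of \<open>\<delta>\<close> at \<open>x\<close> tested on the
  shifted sequence \<open>s n - s n x \<longlonglongrightarrow> l - l x\<close>, all of whose members vanish at \<open>x\<close>.\<close>

lemma continuous_map_delta_imp_equicontinuous:
  assumes cont: "continuous_map X (Cs (Ck X)) (delta X)" and S: "convergent_seq_set (Ck X) S"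
  shows "equicontinuous X S"
  unfolding equicontinuous_def
proof (intro ballI allI impI)
  fix x and \<epsilon> :: real assume x: "x \<in> topspace X" and e: "\<epsilon> > 0"
  obtain s l where s: "range s \<subseteq> real_cfuns X" and lim: "limitin (Ck X) s l sequentially"
      and S_eq: "S = insert l (range s)"
    using S unfolding convergent_seq_set_def by auto
  have l: "l \<in> real_cfuns X" using lim by (auto dest: limitin_topspace)
  define sh where "sh f = restrict (\<lambda>t. f t - f x) (topspace X)" for f :: "'a \<Rightarrow> real"
  have sh: "sh f \<in> real_cfuns X" if "f \<in> real_cfuns X" for f
    unfolding sh_def
    by (intro restrict_in_real_cfuns continuous_map_diff real_cfunsD[OF that]) simp
  have "limitin (Ck X) (\<lambda>n. sh (s n)) (sh l) sequentially"
    unfolding limitin_Ck_iff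
  proof (intro conjI allI impI)
    show "sh l \<in> real_cfuns X" using sh l .
    fix K and \<eta> :: real assume K: "compactin X K \<and> \<eta> > 0"
    \<comment> \<open>The shift subtracts the value at \<open>x\<close>, so closeness is required at
      \<open>x\<close> as well as on \<open>K\<close>, with half of the bound for each.\<close>
    then have "compactin X (insert x K)"
      using compactin_Un[of X "{x}" K] x by simp
    then have "\<forall>\<^sub>F n in sequentially. s n \<in> real_cfuns X \<and> (\<forall>t\<in>insert x K. \<bar>s n t - l t\<bar> < \<eta>/2)"
      using lim K half_gt_zero[of \<eta>] unfolding limitin_Ck_iff by blast
    then show "\<forall>\<^sub>F n in sequentially. sh (s n) \<in> real_cfuns X \<and> (\<forall>t\<in>K. \<bar>sh (s n) t - sh l t\<bar> < \<eta>)"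
    proof eventually_elim
      case (elim n)
      have "\<bar>sh (s n) t - sh l t\<bar> < \<eta>" if t: "t \<in> K" for t
      proof -
        have "t \<in> topspace X" using K t compactin_subset_topspace by blast
        moreover have "\<bar>s n t - l t\<bar> < \<eta>/2" "\<bar>s n x - l x\<bar> < \<eta>/2" using elim t by auto
        ultimately show ?thesis
          using abs_triangle_ineq4[of "s n t - l t" "s n x - l x"]
          by (simp add: sh_def algebra_simps)
      qed
      then show ?case using sh elim by blast
    qed
  qed
  then have "convergent_seq_set (Ck X) (sh ` S)"
    unfolding convergent_seq_set_def S_eq
    by (intro exI[of _ "\<lambda>n. sh (s n)"] exI[of _ "sh l"]) (use s sh in auto)
  \<comment> \<open>As all shifted functions vanish at \<open>x\<close>, one interval about 0 serves
    for the whole of \<open>S\<close>.\<close>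
  then have "openin X {t \<in> topspace X. \<forall>f\<in>sh ` S. f t \<in> {-\<epsilon><..<\<epsilon>}}" (is "openin X ?V")
    using cont[unfolded continuous_map_delta_iff, rule_format, of "sh ` S" "{-\<epsilon><..<\<epsilon>}"] by simp
  moreover have "x \<in> ?V" using x e by (simp add: sh_def)
  moreover have "\<bar>f t - f x\<bar> < \<epsilon>" if "t \<in> ?V" "f \<in> S" for t f
    using that by (auto simp: sh_def abs_less_iff)
  ultimately show "\<exists>U. openin X U \<and> x \<in> U \<and> (\<forall>t\<in>U. \<forall>f\<in>S. \<bar>f t - f x\<bar> < \<epsilon>)"
    by blast
qed

section \<open>The canonical map as an embedding\<close>

lemma tychonoff_separating_function:
  assumes "tychonoff_space X" "openin X U" "x \<in> U"
  obtains f where "f \<in> real_cfuns X" "f x = 0" "\<And>y. y \<in> topspace X - U \<Longrightarrow> f y = 1"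
proof -
  obtain g where g: "continuous_map X euclideanreal g" "g x = 0" "g ` (topspace X - U) \<subseteq> {1}"
    using assms unfolding tychonoff_space_def completely_regular_space_alt' by metis
  show thesis
    by (rule that[OF restrict_in_real_cfuns[OF g(1)]])
       (use g assms openin_subset[OF assms(2)] in auto)
qed

text \<open>Separating functions give both missing properties. One with \<open>f x = 0\<close> and
  \<open>f y = 1\<close> distinguishes the images of \<open>x\<close> and \<open>y\<close>; one
  vanishing at \<open>x\<close> and equal to 1 off \<open>V\<close> cuts out, by
  \<open>F f < 1\<close>, a neighbourhood of \<open>delta X x\<close> in the image that lies in the
  image of \<open>V\<close>.\<close>

lemma embedding_map_delta:
  assumes T: "tychonoff_space X" and cont: "continuous_map X (Cs (Ck X)) (delta X)"
  shows "embedding_map X (Cs (Ck X)) (delta X)"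
  unfolding embedding_map_def
proof (rule bijective_open_imp_homeomorphic_map)
  let ?Y = "subtopology (Cs (Ck X)) (delta X ` topspace X)"
  show "continuous_map X ?Y (delta X)"
    using cont by (simp add: continuous_map_in_subtopology)
  show "delta X ` topspace X = topspace ?Y"
    using delta_in_real_cfuns by fastforce
  show "inj_on (delta X) (topspace X)"
  proof (rule inj_onI, rule ccontr)
    fix x y assume xy: "x \<in> topspace X" "y \<in> topspace X" "delta X x = delta X y" "x \<noteq> y"
    then obtain U where "openin X U" "x \<in> U" "y \<notin> U"
      using T unfolding tychonoff_space_def Hausdorff_space_def disjnt_def by (metis Int_iff empty_iff)
    then obtain f where f: "f \<in> real_cfuns X" "f x = 0" "f y = 1"
      using tychonoff_separating_function[OF T] xy by (metis DiffI)
    from fun_cong[OF xy(3), of f] f show False by (simp add: delta_def)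
  qed
  show "open_map X ?Y (delta X)"
    unfolding open_map_def
  proof (intro allI impI, subst openin_subopen, intro ballI)
    fix V z assume V: "openin X V" and "z \<in> delta X ` V"
    then obtain x where x: "x \<in> V" "z = delta X x" by blast
    then have xX: "x \<in> topspace X" using V openin_subset by blast
    obtain f where f: "f \<in> real_cfuns X" "f x = 0" "\<And>y. y \<in> topspace X - V \<Longrightarrow> f y = 1"
      using tychonoff_separating_function[OF T V x(1)] by metis
    let ?W = "{F \<in> real_cfuns (Ck X). F ` {f} \<subseteq> {..<1}}"
    have "openin (Cs (Ck X)) ?W"
      unfolding Cs_def
      by (rule openin_set_open_topology)
         (use f in \<open>auto intro!: exI[of _ "{{f}}"] convergent_seq_set_singleton\<close>)
    then have "openin ?Y (?W \<inter> delta X ` topspace X)"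
      by (auto simp: openin_subtopology)
    moreover have "z \<in> ?W \<inter> delta X ` topspace X"
      using x xX f delta_in_real_cfuns by (auto simp: delta_def)
    moreover have "?W \<inter> delta X ` topspace X \<subseteq> delta X ` V"
    proof clarify
      fix y assume "y \<in> topspace X" "delta X y ` {f} \<subseteq> {..<1}"
      then have "f y < 1" using f(1) by (simp add: delta_def)
      then have "y \<in> V" using f(3)[of y] \<open>y \<in> topspace X\<close> by auto
      then show "delta X y \<in> delta X ` V" by blast
    qed
    ultimately show "\<exists>T. openin ?Y T \<and> z \<in> T \<and> T \<subseteq> delta X ` V" by blast
  qed
qed

section \<open>Dense sequentially Ascoli subspaces\<close>

text \<open>Compact subsets of \<open>D\<close> are compact in \<open>X\<close>, so restriction to
  \<open>D\<close> preserves convergent sequences. Equicontinuity of the restrictions at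
  \<open>x\<close> is then carried from \<open>D\<close> to \<open>X\<close> by density.\<close>

lemma dense_Ascoli_subspaces_imp_equicontinuous:
  assumes D: "\<And>x. x \<in> topspace X \<Longrightarrow> \<exists>D \<subseteq> topspace X. x \<in> D \<and> X closure_of D = topspace X
            \<and> sequentially_Ascoli (subtopology X D)"
    and S: "convergent_seq_set (Ck X) S"
  shows "equicontinuous X S"
  unfolding equicontinuous_def
proof (intro ballI allI impI)
  fix x and \<epsilon> :: real assume x: "x \<in> topspace X" and e: "\<epsilon> > 0"
  obtain D where D: "D \<subseteq> topspace X" "x \<in> D" "X closure_of D = topspace X"
      "sequentially_Ascoli (subtopology X D)"
    using D x by blast
  obtain s l where s: "range s \<subseteq> real_cfuns X" and lim: "limitin (Ck X) s l sequentially"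
      and S_eq: "S = insert l (range s)"
    using S unfolding convergent_seq_set_def by auto
  have l: "l \<in> real_cfuns X" using lim by (auto dest: limitin_topspace)
  let ?r = "\<lambda>f :: 'a \<Rightarrow> real. restrict f D"
  have r: "?r f \<in> real_cfuns (subtopology X D)" if "f \<in> real_cfuns X" for f
    using restrict_in_real_cfuns[OF continuous_map_from_subtopology[OF real_cfunsD[OF that]], of D] D(1)
    by (simp add: Int_absorb1)
  have "limitin (Ck (subtopology X D)) (\<lambda>n. ?r (s n)) (?r l) sequentially"
    unfolding limitin_Ck_iff
  proof (intro conjI allI impI)
    show "?r l \<in> real_cfuns (subtopology X D)" using r l .
    fix K and \<eta> :: real assume K: "compactin (subtopology X D) K \<and> \<eta> > 0"
    then have "\<forall>\<^sub>F n in sequentially. s n \<in> real_cfuns X \<and> (\<forall>t\<in>K. \<bar>s n t - l t\<bar> < \<eta>)"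
      using lim unfolding limitin_Ck_iff compactin_subtopology by blast
    then show "\<forall>\<^sub>F n in sequentially. ?r (s n) \<in> real_cfuns (subtopology X D) \<and>
        (\<forall>t\<in>K. \<bar>?r (s n) t - ?r l t\<bar> < \<eta>)"
      by (rule eventually_mono) (use K r in \<open>auto simp: compactin_subtopology subset_iff\<close>)
  qed
  then have "convergent_seq_set (Ck (subtopology X D)) (?r ` S)"
    unfolding convergent_seq_set_def S_eq
    by (intro exI[of _ "\<lambda>n. ?r (s n)"] exI[of _ "?r l"]) (use s r in auto)
  then have "equicontinuous (subtopology X D) (?r ` S)"
    using D(4) by (simp add: sequentially_Ascoli_def)
  then obtain V where V: "openin (subtopology X D) V" "x \<in> V"
      "\<forall>t\<in>V. \<forall>f\<in>?r ` S. \<bar>f t - f x\<bar> < \<epsilon>/3"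
    using x D e unfolding equicontinuous_def by (metis IntI divide_pos_pos topspace_subtopology zero_less_numeral)
  then obtain U where U: "openin X U" "V = U \<inter> D" by (auto simp: openin_subtopology)
  \<comment> \<open>\<open>U\<close> serves all \<open>f\<close> at once; the neighbourhood
    \<open>W\<close> of \<open>t\<close> may depend on \<open>f\<close>, as it only supplies a point
    \<open>y\<close> of \<open>D\<close> in \<open>U\<close> at which \<open>f\<close> is close to
    \<open>f t\<close>.\<close>
  have "\<bar>f t - f x\<bar> < \<epsilon>" if t: "t \<in> U" and f: "f \<in> S" for t f
  proof -
    have tX: "t \<in> topspace X" using t U openin_subset by blast
    have "f \<in> real_cfuns X" using f s l S_eq by auto
    then obtain W where W: "openin X W" "t \<in> W" "\<forall>y\<in>W. \<bar>f y - f t\<bar> < \<epsilon>/3"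
      using real_cfunsD[of f X, unfolded continuous_map_real_iff, rule_format, of t "\<epsilon>/3"] tX e
      by auto
    then obtain y where y: "y \<in> D" "y \<in> W" "y \<in> U"
      using D(3) tX U t in_closure_of[of t X D] openin_Int[of X W U] by blast
    then have "\<bar>f y - f x\<bar> < \<epsilon>/3" using V U D f by auto
    moreover have "\<bar>f y - f t\<bar> < \<epsilon>/3" using W y by blast
    ultimately show ?thesis using e by linarith
  qed
  with U V show "\<exists>U. openin X U \<and> x \<in> U \<and> (\<forall>t\<in>U. \<forall>f\<in>S. \<bar>f t - f x\<bar> < \<epsilon>)" by blast
qed

section \<open>Compact-finite and locally finite sequences of zero sets\<close>

text \<open>If \<open>g\<close> vanishes exactly on \<open>A\<close> and \<open>h\<close> exactly
  off \<open>U\<close>, then \<open>A \<subseteq> U\<close> excludes common zeros, and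
  \<open>\<bar>h\<bar> / (\<bar>g\<bar> + \<bar>h\<bar>)\<close> is continuous with the required
  values.\<close>

lemma functionally_separated:
  assumes A: "functionally_closed X A" and U: "functionally_open X U" and "A \<subseteq> U"
  obtains f where "f \<in> real_cfuns X" "\<And>x. x \<in> A \<Longrightarrow> f x = 1" "\<And>x. x \<in> topspace X - U \<Longrightarrow> f x = 0"
proof -
  obtain g where g: "continuous_map X euclideanreal g" "A = {x \<in> topspace X. g x = 0}"
    using A unfolding functionally_closed_def by blast
  obtain h where h: "continuous_map X euclideanreal h" "topspace X - U = {x \<in> topspace X. h x = 0}"
    using U unfolding functionally_open_def functionally_closed_def by blast
  have ne: "\<bar>g x\<bar> + \<bar>h x\<bar> \<noteq> 0" if "x \<in> topspace X" for x
  proof -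
    have "g x \<noteq> 0 \<or> h x \<noteq> 0" using g h that \<open>A \<subseteq> U\<close> by blast
    then show ?thesis by linarith
  qed
  let ?f = "restrict (\<lambda>x. \<bar>h x\<bar> / (\<bar>g x\<bar> + \<bar>h x\<bar>)) (topspace X)"
  show thesis
  proof
    show "?f \<in> real_cfuns X"
      by (intro restrict_in_real_cfuns continuous_map_real_divide continuous_map_add
          continuous_map_real_abs g h ne)
    show "?f x = 1" if "x \<in> A" for x
      using that ne[of x] g by auto
    show "?f x = 0" if "x \<in> topspace X - U" for x
      using that h by auto
  qed
qed

text \<open>Take \<open>s n\<close> equal to 1 on \<open>A n\<close> and 0 off \<open>U n\<close>. A
  compact set meets only finitely many \<open>U n\<close>, so \<open>s n\<close> tends to 0 in
  \<open>Ck X\<close>. Equicontinuity at \<open>x\<close> then gives a neighbourhood that meets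
  \<open>A n\<close> only if \<open>x \<in> U n\<close>, which happens for finitely many
  \<open>n\<close>.\<close>

lemma sequentially_Ascoli_imp_locally_finite:
  fixes A :: "nat \<Rightarrow> 'a set"
  assumes X: "sequentially_Ascoli X" and A: "\<And>n. functionally_closed X (A n)"
    and fin: "strongly_functionally_compact_finite X UNIV A"
  shows "locally_finite_family X UNIV A"
proof -
  obtain U where U: "\<And>n. functionally_open X (U n)" "\<And>n. A n \<subseteq> U n" and cf: "compact_finite X UNIV U"
    using fin unfolding strongly_functionally_compact_finite_def by auto
  have "\<exists>f. f \<in> real_cfuns X \<and> (\<forall>x\<in>A n. f x = 1) \<and> (\<forall>x\<in>topspace X - U n. f x = 0)" for n
    using functionally_separated[OF A U] by metis
  then obtain s where s: "\<And>n. s n \<in> real_cfuns X" "\<And>n x. x \<in> A n \<Longrightarrow> s n x = 1"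
      "\<And>n x. x \<in> topspace X - U n \<Longrightarrow> s n x = 0"
    by metis
  have ev: "\<forall>\<^sub>F n in sequentially. K \<inter> U n = {}" if "compactin X K" for K
    using cf that unfolding compact_finite_def
    by (simp add: eventually_cofinite flip: cofinite_eq_sequentially)
  define z where "z = restrict (\<lambda>_. 0 :: real) (topspace X)"
  have "limitin (Ck X) s z sequentially"
    unfolding limitin_Ck_iff
  proof (intro conjI allI impI)
    show "z \<in> real_cfuns X" unfolding z_def by (rule restrict_in_real_cfuns) simp
    fix K and \<eta> :: real assume K: "compactin X K \<and> \<eta> > 0"
    then have sub: "K \<subseteq> topspace X" by (simp add: compactin_subset_topspace)
    have "\<forall>\<^sub>F n in sequentially. K \<inter> U n = {}" using K ev by blast
    then show "\<forall>\<^sub>F n in sequentially. s n \<in> real_cfuns X \<and> (\<forall>x\<in>K. \<bar>s n x - z x\<bar> < \<eta>)"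
    proof eventually_elim
      case (elim n)
      have "s n x = 0 \<and> z x = 0" if "x \<in> K" for x
        using elim sub s(3)[of x n] that unfolding z_def by auto
      then show ?case using s(1) K by simp
    qed
  qed
  then have "convergent_seq_set (Ck X) (insert z (range s))"
    unfolding convergent_seq_set_def using s(1) by auto
  then have eq: "equicontinuous X (insert z (range s))"
    using X by (simp add: sequentially_Ascoli_def)
  show ?thesis
    unfolding locally_finite_family_def
  proof
    fix x assume x: "x \<in> topspace X"
    \<comment> \<open>The bound 1 is the jump of \<open>s n\<close> between \<open>A n\<close> and
      the complement of \<open>U n\<close>, so the strict estimate rules out
      \<open>t \<in> A n\<close> together with \<open>x \<notin> U n\<close>.\<close>
    obtain V where V: "openin X V" "x \<in> V" "\<And>t n. t \<in> V \<Longrightarrow> \<bar>s n t - s n x\<bar> < 1"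
      using eq x unfolding equicontinuous_def by (metis insertCI rangeI zero_less_one)
    have "finite {n. {x} \<inter> U n \<noteq> {}}"
      using cf[unfolded compact_finite_def, rule_format, of "{x}"] x by simp
    moreover have "{n \<in> UNIV. V \<inter> A n \<noteq> {}} \<subseteq> {n. {x} \<inter> U n \<noteq> {}}"
    proof
      fix n assume "n \<in> {n \<in> UNIV. V \<inter> A n \<noteq> {}}"
      then obtain t where t: "t \<in> V" "t \<in> A n" by blast
      then have "x \<in> U n" using V(3)[of t n] s(2)[of t n] s(3)[of x n] x by fastforce
      then show "n \<in> {n. {x} \<inter> U n \<noteq> {}}" by simp
    qed
    ultimately have "finite {n \<in> UNIV. V \<inter> A n \<noteq> {}}" by (rule rev_finite_subset)
    with V show "\<exists>V. openin X V \<and> x \<in> V \<and> finite {n \<in> UNIV. V \<inter> A n \<noteq> {}}" by blast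
  qed
qed

lemma functionally_closed_ge:
  assumes "continuous_map X euclideanreal f"
  shows "functionally_closed X {x \<in> topspace X. f x \<ge> a}"
  unfolding functionally_closed_def
proof (intro exI conjI)
  \<comment> \<open>This function is zero exactly where \<open>f x \<ge> a\<close>.\<close>
  show "continuous_map X euclideanreal (\<lambda>x. max 0 (a - f x))"
    using assms by (intro continuous_map_real_max continuous_map_diff) auto
qed (auto simp: max_def)

lemma functionally_open_gt:
  assumes "continuous_map X euclideanreal f"
  shows "functionally_open X {x \<in> topspace X. f x > a}"
proof -
  have "functionally_closed X {x \<in> topspace X. - f x \<ge> - a}"
    using assms by (intro functionally_closed_ge continuous_map_minus)
  then show ?thesis
    unfolding functionally_open_def
    by (auto elim!: back_subst[of "functionally_closed X"])
qed

text \<open>Near \<open>x\<close> all but finitely many \<open>s n\<close> stay within \<epsilon>/3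
  of \<open>l\<close>, so they inherit the small oscillation of \<open>l\<close>; the finitely many
  others are handled by their own continuity.\<close>

lemma locally_finite_imp_equicontinuous:
  assumes lf: "\<And>A :: nat \<Rightarrow> 'a set. \<lbrakk>\<And>n. functionally_closed X (A n);
      strongly_functionally_compact_finite X UNIV A\<rbrakk> \<Longrightarrow> locally_finite_family X UNIV A"
    and S: "convergent_seq_set (Ck X) S"
  shows "equicontinuous X S"
  unfolding equicontinuous_def
proof (intro ballI allI impI)
  fix x and \<epsilon> :: real assume x: "x \<in> topspace X" and e: "\<epsilon> > 0"
  obtain s l where s: "range s \<subseteq> real_cfuns X" and lim: "limitin (Ck X) s l sequentially"
      and S_eq: "S = insert l (range s)"
    using S unfolding convergent_seq_set_def by auto
  have l: "l \<in> real_cfuns X" using lim by (auto dest: limitin_topspace)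
  have sn: "s n \<in> real_cfuns X" for n using s by blast
  define d where "d n t = \<bar>s n t - l t\<bar>" for n t
  have d: "continuous_map X euclideanreal (d n)" for n
    unfolding d_def by (intro continuous_map_real_abs continuous_map_diff real_cfunsD sn l)
  define A where "A n = {t \<in> topspace X. d n t \<ge> \<epsilon>/3}" for n
  define U where "U n = {t \<in> topspace X. d n t > \<epsilon>/4}" for n
  \<comment> \<open>Convergence in \<open>Ck X\<close> with bound \<epsilon>/4 empties
    \<open>K \<inter> U n\<close> for almost all \<open>n\<close>; \<epsilon>/4 < \<epsilon>/3
    yields \<open>A n \<subseteq> U n\<close>.\<close>
  have "compact_finite X UNIV U"
    unfolding compact_finite_def
  proof (intro allI impI)
    fix K assume "compactin X K"
    then have "\<forall>\<^sub>F n in sequentially. s n \<in> real_cfuns X \<and> (\<forall>x\<in>K. \<bar>s n x - l x\<bar> < \<epsilon>/4)"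
      using lim[unfolded limitin_Ck_iff, THEN conjunct2, rule_format, of K "\<epsilon>/4"] e by simp
    then have "\<forall>\<^sub>F n in sequentially. K \<inter> U n = {}"
      by (rule eventually_mono) (force simp: U_def d_def)
    then show "finite {n \<in> UNIV. K \<inter> U n \<noteq> {}}"
      by (simp add: eventually_cofinite flip: cofinite_eq_sequentially)
  qed
  moreover have "functionally_open X (U n)" for n
    unfolding U_def by (rule functionally_open_gt[OF d])
  moreover have "A n \<subseteq> U n" for n
    unfolding A_def U_def using e by auto
  ultimately have "strongly_functionally_compact_finite X UNIV A"
    unfolding strongly_functionally_compact_finite_def by blast
  moreover have "functionally_closed X (A n)" for n
    unfolding A_def by (rule functionally_closed_ge[OF d])
  ultimately have "locally_finite_family X UNIV A" by (rule lf[rotated])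
  then obtain V where V: "openin X V" "x \<in> V" and fin: "finite {n. V \<inter> A n \<noteq> {}}"
    using x unfolding locally_finite_family_def by auto
  \<comment> \<open>The exceptional functions, together with the limit \<open>l\<close> through
    which all others are estimated.\<close>
  define T where "T = insert l (s ` {n. V \<inter> A n \<noteq> {}})"
  have T: "finite T" "T \<noteq> {}" "T \<subseteq> real_cfuns X" unfolding T_def using fin s l by auto
  have "\<exists>W. openin X W \<and> x \<in> W \<and> (\<forall>t\<in>W. \<bar>f t - f x\<bar> < \<epsilon>/3)" if "f \<in> T" for f
    using real_cfunsD[of f X, unfolded continuous_map_real_iff, rule_format, of x "\<epsilon>/3"] T(3) that x e
    by auto
  then obtain W where W: "\<And>f. f \<in> T \<Longrightarrow> openin X (W f)" "\<And>f. f \<in> T \<Longrightarrow> x \<in> W f"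
      "\<And>f t. \<lbrakk>f \<in> T; t \<in> W f\<rbrakk> \<Longrightarrow> \<bar>f t - f x\<bar> < \<epsilon>/3"
    by metis
  let ?N = "V \<inter> \<Inter>(W ` T)"
  have "openin X ?N" using V W T by (intro openin_Int openin_Inter) auto
  moreover have "x \<in> ?N" using V W by blast
  moreover have "\<bar>f t - f x\<bar> < \<epsilon>" if t: "t \<in> ?N" and f: "f \<in> S" for t f
  proof (cases "f \<in> T")
    case True
    then have "\<bar>f t - f x\<bar> < \<epsilon>/3" using W(3) t by blast
    then show ?thesis using e by linarith
  next
    case False
    then obtain n where n: "f = s n" "V \<inter> A n = {}"
      using f S_eq unfolding T_def by blast
    have "t \<in> V" "t \<in> topspace X" using t V openin_subset by blast+
    then have "d n t < \<epsilon>/3" "d n x < \<epsilon>/3"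
      using n(2) V x unfolding A_def by force+
    moreover have "\<bar>l t - l x\<bar> < \<epsilon>/3"
      using W(3)[of l t] t unfolding T_def by blast
    ultimately show ?thesis unfolding d_def n(1) by linarith
  qed
  ultimately show "\<exists>U. openin X U \<and> x \<in> U \<and> (\<forall>t\<in>U. \<forall>f\<in>S. \<bar>f t - f x\<bar> < \<epsilon>)"
    by (intro exI[of _ ?N]) blast
qed

theorem theorem2p7:
  fixes X :: "'a topology"
  assumes "tychonoff_space X"
  shows "(sequentially_R_Ascoli X \<longleftrightarrow> continuous_map X (Cs (Ck X)) (delta X))
    \<and> (sequentially_R_Ascoli X \<longleftrightarrow> embedding_map X (Cs (Ck X)) (delta X))
    \<and> (sequentially_R_Ascoli X \<longleftrightarrow>
         (\<forall>x \<in> topspace X. \<exists>D \<subseteq> topspace X. x \<in> D \<and> X closure_of D = topspace X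
            \<and> sequentially_Ascoli (subtopology X D)))
    \<and> (sequentially_R_Ascoli X \<longleftrightarrow> sequentially_Ascoli X)
    \<and> (sequentially_R_Ascoli X \<longleftrightarrow>
         (\<forall>A :: nat \<Rightarrow> 'a set.
            (\<forall>n. functionally_closed X (A n)) \<and> strongly_functionally_compact_finite X UNIV A
            \<longrightarrow> locally_finite_family X UNIV A))"
    (is "(_ \<longleftrightarrow> ?ii) \<and> (_ \<longleftrightarrow> ?iii) \<and> (_ \<longleftrightarrow> ?iv) \<and> (_ \<longleftrightarrow> ?v) \<and> (_ \<longleftrightarrow> ?vi)")
proof -
  have v: "?v \<longleftrightarrow> (\<forall>S. convergent_seq_set (Ck X) S \<longrightarrow> equicontinuous X S)"
    using assms by (simp add: sequentially_Ascoli_def)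
  have ii: "?v \<longleftrightarrow> ?ii"
    unfolding v using equicontinuous_imp_continuous_map_delta
      continuous_map_delta_imp_equicontinuous by metis
  have iii: "?ii \<longleftrightarrow> ?iii"
    using embedding_map_delta[OF assms] homeomorphic_imp_continuous_map
      continuous_map_into_fulltopology unfolding embedding_map_def by blast
  have "?iv" if "?v"
    \<comment> \<open>The whole space serves as the dense subspace for every point.\<close>
    using that by (auto intro!: exI[of _ "topspace X"])
  moreover have "?v" if "?iv"
    unfolding v using dense_Ascoli_subspaces_imp_equicontinuous[OF bspec[OF that]] by simp
  ultimately have iv: "?v \<longleftrightarrow> ?iv" by blast
  have "?vi" if "?v"
    using sequentially_Ascoli_imp_locally_finite[OF that] by blast
  moreover have "?v" if "?vi"
    unfolding v using locally_finite_imp_equicontinuous that by blast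
  ultimately have vi: "?v \<longleftrightarrow> ?vi" by blast
  show ?thesis
    \<comment> \<open>This replaces (i) by (v), the hub to which the other conditions have been
      linked.\<close>
    unfolding sequentially_R_Ascoli_iff using ii iii iv vi by blast
qed

end
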